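(* Let $\mathrm{st}$ be a shuffle-compatible statistic on set partitions. (1) The statistic $\mathrm{st}$ is weakly shuffle-compatible on set partitions. (2) The shuffle algebra $\mathcal{A}^{\Psi}_{\mathrm{st}}$ is isomorphic (as a $\mathbb{Q}$-algebra) to the shifted shuffle algebra $\mathcal{A}^{\Pi}_{\mathrm{st}}$. (3) The shuffle algebra $\mathcal{A}^{\Psi}_{\mathrm{st}}$ is a quotient of $\mathrm{NCSym}^*$, i.e. isomorphic as a $\mathbb{Q}$-algebra to $\mathrm{NCSym}^*/I$ for some two-sided ideal $I$.
   Context: All algebras are over $\mathbb{Q}$. $\Psi$ is the set of all set partitions of finite subsets of $\{1,2,3,\dots\}$; for $\pi\in\Psi$ a partition of $I$ (written $\pi\vdash I$), $|\pi|=|I|$. $\Pi\subset\Psi$ is the set of set partitions of the sets $[n]=\{1,\dots,n\}$, $n\ge0$. Two set partitions $\tau\vdash I,\theta\vdash J$ are disjoint if $I\cap J=\emptyset$. For $\pi\vdash\{i_1<\dots<i_n\}$ and $S=\{s_1<\dots<s_n\}$, $\mathrm{shift}_S(\pi)$ is the set partition of $S$ obtained by replacing each $i_j$ by $s_j$; the standardization is $\mathrm{std}(\pi)=\mathrm{shift}_{[n]}(\pi)$. For disjoint $\tau\vdash I,\theta\vdash J$ the arc-shuffle is the multiset (indexed by $S$) $\mathrm{ASh}(\tau,\theta)=\{\{\mathrm{shift}_S(\tau)\cup\mathrm{shift}_{(I\cup J)\setminus S}(\theta):S\subseteq I\cup J,|S|=|I|\}\}$. For $\tau\vdash[n],\theta\vdash[m]$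 the shifted arc-shuffle is $\overrightarrow{\mathrm{ASh}}(\tau,\theta)=\mathrm{ASh}(\tau,\theta[n])$, where $\theta[n]$ is $\theta$ with $n$ added to every element. A statistic $\mathrm{st}$ on $\Psi$ is shuffle-compatible on set partitions if (i) for all disjoint $\tau,\theta\in\Psi$ the multiset $\{\{\mathrm{st}(\pi):\pi\in\mathrm{ASh}(\tau,\theta)\}\}$ is determined by $\mathrm{st}(\tau),\mathrm{st}(\theta),|\tau|,|\theta|$; and (ii) $\mathrm{std}(\tau)=\mathrm{std}(\theta)$ implies $\mathrm{st}(\tau)=\mathrm{st}(\theta)$. It is weakly shuffle-compatible on set partitions if for all $\tau,\theta\in\Pi$ the multiset $\{\{\mathrm{st}(\pi):\pi\in\overrightarrow{\mathrm{ASh}}(\tau,\theta)\}\}$ is determined by $\mathrm{st}(\tau),\mathrm{st}(\theta),|\tau|,|\theta|$. For $X\in\{\Psi,\Pi\}$, $\pi\in X$, let $[\pi]^X_{\mathrm{st}}=\{\tau\in X:\mathrm{st}(\tau)=\mathrm{st}(\pi),|\tau|=|\pi|\}$. $\mathcal{A}^\Psi_{\mathrm{st}}$ has basis the classes $[\pi]^\Psi_{\mathrm{st}}$ and product $[\tau]^\Psi_{\mathrm{st}}[\theta]^\Psi_{\mathrm{st}}=\sum_{\pi\in\mathrm{ASh}(\tau,\theta)}[\pi]^\Psi_{\mathrm{st}}$ for disjoint representatives. $\mathcal{A}^\Pi_{\mathrm{st}}$ has basis the classes $[\pi]^\Pi_{\mathrm{st}}$ and product $[\tau]^\Pi_{\mathrm{st}}[\theta]^\Pi_{\mathrm{st}}=\sum_{\pi\in\overrightarrow{\mathrm{ASh}}(\tau,\theta)}[\pi]^\Pi_{\mathrm{st}}$.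 $\mathrm{NCSym}^*$ has basis $\{\mathbf{w}_\pi\}_{\pi\in\Pi}$ and product $\mathbf{w}_\tau\mathbf{w}_\theta=\sum_{\pi\in\overrightarrow{\mathrm{ASh}}(\tau,\theta)}\mathbf{w}_\pi$. All sums are with multiplicity. *)

theory Defs
  imports
    "HOL-Library.Multiset"
    "HOL-Library.Disjoint_Sets"
    "HOL-Library.Poly_Mapping"
    "HOL-Algebra.Module"
    "HOL-Algebra.QuotRing"
    "HOL-Algebra.Algebraic_Closure_Type"
begin

section \<open>Set partitions and arc-shuffles\<close>

text \<open>A set partition is the set of its blocks; its ground set is the union of the blocks
  (blocks are nonempty), so a partition of the empty set is \<open>{}\<close>.\<close>

type_synonym setpart = "nat set set"

definition Psi :: "setpart set" where
  "Psi = {\<pi>. finite (\<Union>\<pi>) \<and> 0 \<notin> \<Union>\<pi> \<and> partition_on (\<Union>\<pi>) \<pi>}"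

definition Pi_std :: "setpart set" where
  "Pi_std = {\<pi>. \<exists>n. partition_on {1..n} \<pi>}"

definition ground_size :: "setpart \<Rightarrow> nat" where
  "ground_size \<pi> = card (\<Union>\<pi>)"

definition disjoint_parts :: "setpart \<Rightarrow> setpart \<Rightarrow> bool" where
  "disjoint_parts \<tau> \<theta> \<longleftrightarrow> \<Union>\<tau> \<inter> \<Union>\<theta> = {}"

text \<open>The element \<open>i\<close> of \<open>I\<close> with exactly \<open>k\<close> smaller elements in \<open>I\<close> is replaced by the
  element of \<open>S\<close> at (0-based) position \<open>k\<close>; only used when \<open>card S = card I\<close>.\<close>

definition relabel :: "nat set \<Rightarrow> nat set \<Rightarrow> nat \<Rightarrow> nat" where
  "relabel I S i = sorted_list_of_set S ! card {j \<in> I. j < i}"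

definition shift :: "nat set \<Rightarrow> setpart \<Rightarrow> setpart" where
  "shift S \<pi> = (\<lambda>B. relabel (\<Union>\<pi>) S ` B) ` \<pi>"

definition std :: "setpart \<Rightarrow> setpart" where
  "std \<pi> = shift {1..ground_size \<pi>} \<pi>"

definition ASh :: "setpart \<Rightarrow> setpart \<Rightarrow> setpart multiset" where
  "ASh \<tau> \<theta> = image_mset (\<lambda>S. shift S \<tau> \<union> shift ((\<Union>\<tau> \<union> \<Union>\<theta>) - S) \<theta>)
     (mset_set {S. S \<subseteq> \<Union>\<tau> \<union> \<Union>\<theta> \<and> card S = ground_size \<tau>})"

definition translate :: "nat \<Rightarrow> setpart \<Rightarrow> setpart" where
  "translate n \<theta> = (\<lambda>B. (\<lambda>i. i + n) ` B) ` \<theta>"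

definition ASh_shifted :: "setpart \<Rightarrow> setpart \<Rightarrow> setpart multiset" where
  "ASh_shifted \<tau> \<theta> = ASh \<tau> (translate (ground_size \<tau>) \<theta>)"


section \<open>Shuffle-compatibility\<close>

text \<open>A statistic is a function with values in an arbitrary type; only its values on
  \<open>Psi\<close> matter.\<close>

definition shuffle_compatible :: "(setpart \<Rightarrow> 'b) \<Rightarrow> bool" where
  "shuffle_compatible st \<longleftrightarrow>
     (\<forall>\<tau>\<in>Psi. \<forall>\<theta>\<in>Psi. \<forall>\<tau>'\<in>Psi. \<forall>\<theta>'\<in>Psi.
        disjoint_parts \<tau> \<theta> \<longrightarrow> disjoint_parts \<tau>' \<theta>' \<longrightarrow>
        st \<tau> = st \<tau>' \<longrightarrow> st \<theta> = st \<theta>' \<longrightarrow> ground_size \<tau> = ground_size \<tau>' \<longrightarrow> ground_size \<theta> = ground_size \<theta>' \<longrightarrow>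
        image_mset st (ASh \<tau> \<theta>) = image_mset st (ASh \<tau>' \<theta>')) \<and>
     (\<forall>\<tau>\<in>Psi. \<forall>\<theta>\<in>Psi. std \<tau> = std \<theta> \<longrightarrow> st \<tau> = st \<theta>)"

definition weakly_shuffle_compatible :: "(setpart \<Rightarrow> 'b) \<Rightarrow> bool" where
  "weakly_shuffle_compatible st \<longleftrightarrow>
     (\<forall>\<tau>\<in>Pi_std. \<forall>\<theta>\<in>Pi_std. \<forall>\<tau>'\<in>Pi_std. \<forall>\<theta>'\<in>Pi_std.
        st \<tau> = st \<tau>' \<longrightarrow> st \<theta> = st \<theta>' \<longrightarrow> ground_size \<tau> = ground_size \<tau>' \<longrightarrow> ground_size \<theta> = ground_size \<theta>' \<longrightarrow>
        image_mset st (ASh_shifted \<tau> \<theta>) = image_mset st (ASh_shifted \<tau>' \<theta>'))"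

definition st_class :: "setpart set \<Rightarrow> (setpart \<Rightarrow> 'b) \<Rightarrow> setpart \<Rightarrow> setpart set" where
  "st_class P st \<pi> = {\<tau> \<in> P. st \<tau> = st \<pi> \<and> ground_size \<tau> = ground_size \<pi>}"

definition st_classes :: "setpart set \<Rightarrow> (setpart \<Rightarrow> 'b) \<Rightarrow> setpart set set" where
  "st_classes P st = st_class P st ` P"


section \<open>Associative algebras\<close>

abbreviation Q_field :: "rat ring" where
  "Q_field \<equiv> ring_of_type_algebra"

text \<open>The locale \<open>algebra\<close> of \<open>HOL-Algebra\<close> is restricted to commutative algebras; the
  following is the notion of an associative unital algebra over a commutative ring.\<close>

definition assoc_algebra :: "'a ring \<Rightarrow> ('a, 'c) module \<Rightarrow> bool" where
  "assoc_algebra R A \<longleftrightarrow> module R A \<and> ring A \<and>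
     (\<forall>q\<in>carrier R. \<forall>x\<in>carrier A. \<forall>y\<in>carrier A.
        (q \<odot>\<^bsub>A\<^esub> x) \<otimes>\<^bsub>A\<^esub> y = q \<odot>\<^bsub>A\<^esub> (x \<otimes>\<^bsub>A\<^esub> y) \<and>
        x \<otimes>\<^bsub>A\<^esub> (q \<odot>\<^bsub>A\<^esub> y) = q \<odot>\<^bsub>A\<^esub> (x \<otimes>\<^bsub>A\<^esub> y))"

definition algebra_iso :: "'a ring \<Rightarrow> ('a, 'c) module \<Rightarrow> ('a, 'd) module \<Rightarrow> ('c \<Rightarrow> 'd) set" where
  "algebra_iso R A B = {h \<in> ring_iso A B.
     \<forall>q\<in>carrier R. \<forall>x\<in>carrier A. h (q \<odot>\<^bsub>A\<^esub> x) = q \<odot>\<^bsub>B\<^esub> h x}"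

definition algebra_isomorphic :: "'a ring \<Rightarrow> ('a, 'c) module \<Rightarrow> ('a, 'd) module \<Rightarrow> bool" where
  "algebra_isomorphic R A B \<longleftrightarrow>
     assoc_algebra R A \<and> assoc_algebra R B \<and> algebra_iso R A B \<noteq> {}"

text \<open>The quotient ring \<open>A Quot I\<close> with \<open>q (I + x) = I + q x\<close>, written in the style of
  \<open>rcoset_mult\<close>. A two-sided ring ideal of a unital algebra is automatically
  a submodule, since \<open>q x = (q 1) x\<close>.\<close>

definition quot_algebra :: "('a, 'c) module \<Rightarrow> 'c set \<Rightarrow> ('a, 'c set) module" where
  "quot_algebra A I =
     \<lparr>carrier = carrier (A Quot I), monoid.mult = monoid.mult (A Quot I),
      one = \<one>\<^bsub>A Quot I\<^esub>,
      ring.zero = \<zero>\<^bsub>A Quot I\<^esub>, add = add (A Quot I),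
      module.smult = (\<lambda>q C. \<Union>x\<in>C. I +>\<^bsub>A\<^esub> (q \<odot>\<^bsub>A\<^esub> x))\<rparr>"


section \<open>The algebras\<close>

definition scale :: "rat \<Rightarrow> ('k \<Rightarrow>\<^sub>0 rat) \<Rightarrow> ('k \<Rightarrow>\<^sub>0 rat)" where
  "scale q x = Poly_Mapping.map (\<lambda>r. q * r) x"

text \<open>The space with basis \<open>B\<close>, with the product that extends \<open>m\<close> bilinearly
  and with the basis element \<open>e\<close> as unit.\<close>

definition based_algebra ::
  "'k set \<Rightarrow> 'k \<Rightarrow> ('k \<Rightarrow> 'k \<Rightarrow> ('k \<Rightarrow>\<^sub>0 rat)) \<Rightarrow> (rat, 'k \<Rightarrow>\<^sub>0 rat) module" where
  "based_algebra B e m =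
     \<lparr>carrier = {x. Poly_Mapping.keys x \<subseteq> B},
      monoid.mult = (\<lambda>x y. \<Sum>a\<in>Poly_Mapping.keys x. \<Sum>b\<in>Poly_Mapping.keys y.
                scale (Poly_Mapping.lookup x a * Poly_Mapping.lookup y b) (m a b)),
      one = Poly_Mapping.single e 1,
      ring.zero = 0,
      add = (+),
      module.smult = scale\<rparr>"

definition formal_sum :: "'k multiset \<Rightarrow> ('k \<Rightarrow>\<^sub>0 rat)" where
  "formal_sum M = (\<Sum>k\<in>#M. Poly_Mapping.single k 1)"

text \<open>The products of classes are computed from chosen representatives. That suitable
  representatives exist and that the choice is irrelevant is proved below
  (\<open>disjoint_representatives\<close>, \<open>Psi_mult_class\<close>, \<open>Pi_mult_class\<close>).\<close>

definition Psi_mult ::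
  "(setpart \<Rightarrow> 'b) \<Rightarrow> setpart set \<Rightarrow> setpart set \<Rightarrow> (setpart set \<Rightarrow>\<^sub>0 rat)" where
  "Psi_mult st C D =
     (let (\<tau>, \<theta>) = (SOME (\<tau>, \<theta>). \<tau> \<in> C \<and> \<theta> \<in> D \<and> disjoint_parts \<tau> \<theta>)
      in formal_sum (image_mset (st_class Psi st) (ASh \<tau> \<theta>)))"

definition Pi_mult ::
  "(setpart \<Rightarrow> 'b) \<Rightarrow> setpart set \<Rightarrow> setpart set \<Rightarrow> (setpart set \<Rightarrow>\<^sub>0 rat)" where
  "Pi_mult st C D =
     (let (\<tau>, \<theta>) = (SOME (\<tau>, \<theta>). \<tau> \<in> C \<and> \<theta> \<in> D)
      in formal_sum (image_mset (st_class Pi_std st) (ASh_shifted \<tau> \<theta>)))"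

definition A_Psi :: "(setpart \<Rightarrow> 'b) \<Rightarrow> (rat, setpart set \<Rightarrow>\<^sub>0 rat) module" where
  "A_Psi st = based_algebra (st_classes Psi st) (st_class Psi st {}) (Psi_mult st)"

definition A_Pi :: "(setpart \<Rightarrow> 'b) \<Rightarrow> (rat, setpart set \<Rightarrow>\<^sub>0 rat) module" where
  "A_Pi st = based_algebra (st_classes Pi_std st) (st_class Pi_std st {}) (Pi_mult st)"

definition NCSym_dual :: "(rat, setpart \<Rightarrow>\<^sub>0 rat) module" where
  "NCSym_dual = based_algebra Pi_std {} (\<lambda>\<tau> \<theta>. formal_sum (ASh_shifted \<tau> \<theta>))"


section \<open>The products of classes do not depend on representatives\<close>

lemma rank_bij:
  fixes I :: "nat set"
  assumes "finite I"
  shows "bij_betw (\<lambda>i. card {j \<in> I. j < i}) I {..<card I}"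
proof -
  have lt: "card {j \<in> I. j < a} < card {j \<in> I. j < b}" if "a \<in> I" "a < b" for a b
    by (rule psubset_card_mono) (use that assms in auto)
  have "inj_on (\<lambda>i. card {j \<in> I. j < i}) I"
  proof (rule inj_onI, rule ccontr)
    fix a b assume "a \<in> I" "b \<in> I" "card {j \<in> I. j < a} = card {j \<in> I. j < b}" "a \<noteq> b"
    then show False using lt[of a b] lt[of b a] by (cases a b rule: linorder_cases) auto
  qed
  moreover have "(\<lambda>i. card {j \<in> I. j < i}) ` I \<subseteq> {..<card I}"
  proof
    fix k assume "k \<in> (\<lambda>i. card {j \<in> I. j < i}) ` I"
    then obtain i where i: "i \<in> I" "k = card {j \<in> I. j < i}" by blast
    have "{j \<in> I. j < i} \<subset> I" using i by blast
    then show "k \<in> {..<card I}" using assms i by (simp add: psubset_card_mono)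
  qed
  ultimately show ?thesis
    unfolding bij_betw_def by (simp add: card_image card_subset_eq)
qed

lemma relabel_bij:
  assumes "finite I" "finite S" "card S = card I"
  shows "bij_betw (relabel I S) I S"
proof -
  have "bij_betw (\<lambda>k. sorted_list_of_set S ! k) {..<card I} S"
    by (rule bij_betw_nth) (use assms in auto)
  from bij_betw_trans[OF rank_bij[OF assms(1)] this]
  show ?thesis by (simp add: relabel_def[abs_def] comp_def)
qed

lemma partition_on_shift:
  assumes "finite (\<Union>\<pi>)" "partition_on (\<Union>\<pi>) \<pi>" "finite S" "card S = ground_size \<pi>"
  shows "partition_on S (shift S \<pi>)"
proof -
  have b: "bij_betw (relabel (\<Union>\<pi>) S) (\<Union>\<pi>) S"
    using assms relabel_bij unfolding ground_size_def by blast
  have "partition_on (relabel (\<Union>\<pi>) S ` (\<Union>\<pi>)) ((`) (relabel (\<Union>\<pi>) S) ` \<pi> - {{}})"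
    using assms(2) bij_betw_imp_inj_on[OF b] by (rule partition_on_inj_image)
  moreover have "(`) (relabel (\<Union>\<pi>) S) ` \<pi> - {{}} = shift S \<pi>"
    using assms(2) by (auto simp: shift_def partition_on_def)
  ultimately show ?thesis using b by (simp add: bij_betw_def)
qed

lemma Union_shift:
  assumes "\<pi> \<in> Psi" "finite S" "card S = ground_size \<pi>"
  shows "\<Union>(shift S \<pi>) = S"
  using partition_on_shift[of \<pi> S] assms by (auto simp: Psi_def partition_on_def)

lemma ASh_partition_on:
  assumes "\<tau> \<in> Psi" "\<theta> \<in> Psi" "disjoint_parts \<tau> \<theta>" "\<pi> \<in># ASh \<tau> \<theta>"
  shows "partition_on (\<Union>\<tau> \<union> \<Union>\<theta>) \<pi>"
proof -
  let ?U = "\<Union>\<tau> \<union> \<Union>\<theta>"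
  have fin: "finite (\<Union>\<tau>)" "finite (\<Union>\<theta>)" using assms by (auto simp: Psi_def)
  then have "finite {S. S \<subseteq> ?U \<and> card S = ground_size \<tau>}" by simp
  with assms(4) obtain S where S: "S \<subseteq> ?U" "card S = ground_size \<tau>"
    and \<pi>: "\<pi> = shift S \<tau> \<union> shift (?U - S) \<theta>"
    by (auto simp: ASh_def)
  have finS: "finite S" using S fin by (meson finite_UnI finite_subset)
  have "card ?U = ground_size \<tau> + ground_size \<theta>"
    using assms(3) fin by (simp add: ground_size_def disjoint_parts_def card_Un_disjoint)
  then have c: "card (?U - S) = ground_size \<theta>"
    using S finS by (simp add: card_Diff_subset)
  have 1: "partition_on S (shift S \<tau>)"
    using assms S finS by (intro partition_on_shift) (auto simp: Psi_def)
  have 2: "partition_on (?U - S) (shift (?U - S) \<theta>)"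
    using assms c fin by (intro partition_on_shift) (auto simp: Psi_def)
  have d: "disjnt p q" if "p \<in> shift S \<tau>" "q \<in> shift (?U - S) \<theta>" for p q
  proof -
    have "p \<subseteq> S" "q \<subseteq> ?U - S" using 1 2 that by (auto simp: partition_on_def)
    then show ?thesis by (auto simp: disjnt_def)
  qed
  show ?thesis
  proof (rule partition_onI)
    show "\<Union>\<pi> = ?U" using 1 2 S unfolding \<pi> partition_on_def by auto
    show "{} \<notin> \<pi>" using 1 2 unfolding \<pi> partition_on_def by auto
    show "disjnt p q" if "p \<in> \<pi>" "q \<in> \<pi>" "p \<noteq> q" for p q
      using that 1 2 d d[THEN disjnt_sym] unfolding \<pi> partition_on_def
      by (auto simp: pairwise_def)
  qed
qed

lemma Pi_std_imp_Psi:
  assumes "\<pi> \<in> Pi_std"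
  shows "\<pi> \<in> Psi"
proof -
  from assms obtain n where p: "partition_on {1..n} \<pi>" unfolding Pi_std_def by blast
  then have U: "\<Union>\<pi> = {1..n}" by (rule partition_onD1[symmetric])
  show ?thesis unfolding Psi_def mem_Collect_eq U using p by simp
qed

lemma Pi_std_Union:
  assumes "\<pi> \<in> Pi_std"
  shows "\<Union>\<pi> = {1..ground_size \<pi>}"
proof -
  from assms obtain n where "partition_on {1..n} \<pi>" unfolding Pi_std_def by blast
  then have U: "\<Union>\<pi> = {1..n}" by (rule partition_onD1[symmetric])
  show ?thesis unfolding ground_size_def U by simp
qed

lemma Union_translate: "\<Union>(translate n \<theta>) = (\<lambda>i. i + n) ` \<Union>\<theta>"
  by (auto simp: translate_def)

lemma ground_size_translate: "ground_size (translate n \<theta>) = ground_size \<theta>"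
  by (simp add: ground_size_def Union_translate card_image)

lemma translate_Psi:
  assumes "\<theta> \<in> Psi"
  shows "translate n \<theta> \<in> Psi"
proof -
  have "partition_on ((\<lambda>i. i + n) ` \<Union>\<theta>) ((`) (\<lambda>i. i + n) ` \<theta> - {{}})"
    using assms by (intro partition_on_inj_image) (auto simp: Psi_def)
  moreover have "(`) (\<lambda>i. i + n) ` \<theta> - {{}} = translate n \<theta>"
    using assms by (auto simp: Psi_def translate_def partition_on_def)
  ultimately show ?thesis
    using assms unfolding Psi_def mem_Collect_eq Union_translate by auto
qed

lemma translate_disjoint:
  "\<tau> \<in> Pi_std \<Longrightarrow> \<theta> \<in> Pi_std \<Longrightarrow> disjoint_parts \<tau> (translate (ground_size \<tau>) \<theta>)"
  unfolding disjoint_parts_def Union_translate by (simp only: Pi_std_Union) auto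

lemma ASh_Psi:
  assumes "\<tau> \<in> Psi" "\<theta> \<in> Psi" "disjoint_parts \<tau> \<theta>" "\<pi> \<in># ASh \<tau> \<theta>"
  shows "\<pi> \<in> Psi" "ground_size \<pi> = ground_size \<tau> + ground_size \<theta>"
proof -
  have p: "partition_on (\<Union>\<tau> \<union> \<Union>\<theta>) \<pi>" by (rule ASh_partition_on[OF assms])
  then have U: "\<Union>\<pi> = \<Union>\<tau> \<union> \<Union>\<theta>" by (simp add: partition_on_def)
  show "\<pi> \<in> Psi" using p assms(1,2) unfolding Psi_def mem_Collect_eq U by auto
  show "ground_size \<pi> = ground_size \<tau> + ground_size \<theta>"
    using assms unfolding ground_size_def U by (auto simp: Psi_def disjoint_parts_def intro: card_Un_disjoint)
qed

lemma ASh_shifted_Pi: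
  assumes "\<tau> \<in> Pi_std" "\<theta> \<in> Pi_std" "\<pi> \<in># ASh_shifted \<tau> \<theta>"
  shows "\<pi> \<in> Pi_std" "ground_size \<pi> = ground_size \<tau> + ground_size \<theta>"
proof -
  note r = Pi_std_imp_Psi[OF assms(1)] translate_Psi[OF Pi_std_imp_Psi[OF assms(2)]]
    translate_disjoint[OF assms(1,2)] assms(3)[unfolded ASh_shifted_def]
  show "ground_size \<pi> = ground_size \<tau> + ground_size \<theta>"
    using ASh_Psi(2)[OF r] by (simp add: ground_size_translate)
  have "\<Union>\<tau> \<union> \<Union>(translate (ground_size \<tau>) \<theta>) = {1..ground_size \<tau>} \<union> (\<lambda>i. i + ground_size \<tau>) ` {1..ground_size \<theta>}"
    by (simp only: Union_translate Pi_std_Union[OF assms(1)] Pi_std_Union[OF assms(2)])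
  also have "\<dots> = {1..ground_size \<tau> + ground_size \<theta>}"
    unfolding image_add_atLeastAtMost' by auto
  finally show "\<pi> \<in> Pi_std" using ASh_partition_on[OF r] by (auto simp: Pi_std_def)
qed

lemma st_class_cong:
  assumes "image_mset st M = image_mset st N"
    and "\<And>\<pi>. \<pi> \<in># M + N \<Longrightarrow> ground_size \<pi> = n"
  shows "image_mset (st_class P st) M = image_mset (st_class P st) N"
proof -
  have "image_mset (st_class P st) K = image_mset (\<lambda>v. {\<rho> \<in> P. st \<rho> = v \<and> ground_size \<rho> = n}) (image_mset st K)"
    if "K \<subseteq># M + N" for K
    unfolding multiset.map_comp
    by (rule image_mset_cong) (use that assms(2) in \<open>auto simp: st_class_def dest: mset_subset_eqD\<close>)
  from this[of M] this[of N] show ?thesis using assms(1) by simp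
qed

lemma Psi_mult_class:
  assumes "shuffle_compatible st" "\<tau> \<in> Psi" "\<theta> \<in> Psi" "disjoint_parts \<tau> \<theta>"
  shows "Psi_mult st (st_class Psi st \<tau>) (st_class Psi st \<theta>) =
    formal_sum (image_mset (st_class Psi st) (ASh \<tau> \<theta>))"
proof -
  let ?Q = "\<lambda>(\<tau>', \<theta>'). \<tau>' \<in> st_class Psi st \<tau> \<and> \<theta>' \<in> st_class Psi st \<theta> \<and> disjoint_parts \<tau>' \<theta>'"
  obtain \<tau>' \<theta>' where eq: "(SOME p. ?Q p) = (\<tau>', \<theta>')" by fastforce
  have "?Q (SOME p. ?Q p)" by (rule someI[of ?Q "(\<tau>, \<theta>)"]) (use assms in \<open>auto simp: st_class_def\<close>)
  then have q: "\<tau>' \<in> Psi" "\<theta>' \<in> Psi" "disjoint_parts \<tau>' \<theta>'" "st \<tau>' = st \<tau>" "st \<theta>' = st \<theta>"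
      "ground_size \<tau>' = ground_size \<tau>" "ground_size \<theta>' = ground_size \<theta>"
    unfolding eq by (auto simp: st_class_def)
  have "image_mset (st_class Psi st) (ASh \<tau>' \<theta>') = image_mset (st_class Psi st) (ASh \<tau> \<theta>)"
  proof (rule st_class_cong)
    show "image_mset st (ASh \<tau>' \<theta>') = image_mset st (ASh \<tau> \<theta>)"
      using assms q unfolding shuffle_compatible_def by blast
    show "ground_size \<pi> = ground_size \<tau> + ground_size \<theta>" if "\<pi> \<in># ASh \<tau>' \<theta>' + ASh \<tau> \<theta>" for \<pi>
      using that ASh_Psi(2)[OF q(1-3)] ASh_Psi(2)[OF assms(2-4)] q by auto
  qed
  then show ?thesis by (simp add: Psi_mult_def eq)
qed

lemma Pi_mult_class:
  assumes "weakly_shuffle_compatible st" "\<tau> \<in> Pi_std" "\<theta> \<in> Pi_std"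
  shows "Pi_mult st (st_class Pi_std st \<tau>) (st_class Pi_std st \<theta>) =
    formal_sum (image_mset (st_class Pi_std st) (ASh_shifted \<tau> \<theta>))"
proof -
  let ?Q = "\<lambda>(\<tau>', \<theta>'). \<tau>' \<in> st_class Pi_std st \<tau> \<and> \<theta>' \<in> st_class Pi_std st \<theta>"
  obtain \<tau>' \<theta>' where eq: "(SOME p. ?Q p) = (\<tau>', \<theta>')" by fastforce
  have "?Q (SOME p. ?Q p)" by (rule someI[of ?Q "(\<tau>, \<theta>)"]) (use assms in \<open>auto simp: st_class_def\<close>)
  then have q: "\<tau>' \<in> Pi_std" "\<theta>' \<in> Pi_std" "st \<tau>' = st \<tau>" "st \<theta>' = st \<theta>"
      "ground_size \<tau>' = ground_size \<tau>" "ground_size \<theta>' = ground_size \<theta>"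
    unfolding eq by (auto simp: st_class_def)
  have "image_mset (st_class Pi_std st) (ASh_shifted \<tau>' \<theta>') =
    image_mset (st_class Pi_std st) (ASh_shifted \<tau> \<theta>)"
  proof (rule st_class_cong)
    show "image_mset st (ASh_shifted \<tau>' \<theta>') = image_mset st (ASh_shifted \<tau> \<theta>)"
      using assms q unfolding weakly_shuffle_compatible_def by blast
    show "ground_size \<pi> = ground_size \<tau> + ground_size \<theta>" if "\<pi> \<in># ASh_shifted \<tau>' \<theta>' + ASh_shifted \<tau> \<theta>" for \<pi>
      using that ASh_shifted_Pi(2)[OF q(1-2)] ASh_shifted_Pi(2)[OF assms(2-3)] q by auto
  qed
  then show ?thesis by (simp add: Pi_mult_def eq)
qed

lemma rank_relabel:
  assumes "finite I" "finite S" "card S = card I" "i \<in> I"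
  shows "card {j \<in> S. j < relabel I S i} = card {j \<in> I. j < i}"
proof -
  let ?xs = "sorted_list_of_set S" and ?k = "card {j \<in> I. j < i}"
  have k: "?k < length ?xs"
    using bij_betwE[OF rank_bij[OF assms(1)]] assms by auto
  have mono: "?xs ! a < ?xs ! b \<longleftrightarrow> a < b" if "a < length ?xs" "b < length ?xs" for a b
    using that strict_sorted_list_of_set[of S]
    by (metis linorder_neqE_nat order_less_asym sorted_wrt_nth_less)
  have "{j \<in> S. j < ?xs ! ?k} = (!) ?xs ` {..<?k}"
  proof (intro equalityI subsetI)
    fix j assume "j \<in> {j \<in> S. j < ?xs ! ?k}"
    then obtain a where "a < length ?xs" "j = ?xs ! a" "?xs ! a < ?xs ! ?k"
      using set_sorted_list_of_set[OF assms(2)] by (metis (mono_tags, lifting) in_set_conv_nth mem_Collect_eq)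
    then show "j \<in> (!) ?xs ` {..<?k}" using mono k by blast
  next
    fix j assume "j \<in> (!) ?xs ` {..<?k}"
    then obtain a where a: "a < ?k" "j = ?xs ! a" by auto
    then have "a < length ?xs" using k by simp
    then show "j \<in> {j \<in> S. j < ?xs ! ?k}"
      using a mono k assms(2) nth_mem[of a ?xs] by auto
  qed
  moreover have "inj_on ((!) ?xs) {..<?k}"
    using k by (intro inj_on_nth) auto
  ultimately show ?thesis by (simp add: relabel_def card_image)
qed

lemma std_shift:
  assumes "\<pi> \<in> Psi" "finite S" "card S = ground_size \<pi>"
  shows "std (shift S \<pi>) = std \<pi>"
proof -
  have U: "\<Union>(shift S \<pi>) = S" by (rule Union_shift[OF assms])
  have "relabel S T (relabel (\<Union>\<pi>) S i) = relabel (\<Union>\<pi>) T i" if "i \<in> \<Union>\<pi>" for i T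
    using rank_relabel[of "\<Union>\<pi>" S i] assms that
    by (simp add: relabel_def[of _ T] ground_size_def Psi_def del: Union_iff)
  then have "relabel S T ` relabel (\<Union>\<pi>) S ` B = relabel (\<Union>\<pi>) T ` B" if "B \<in> \<pi>" for B T
    using that by (force simp: image_image intro!: image_cong)
  moreover have "ground_size (shift S \<pi>) = ground_size \<pi>" using U assms(3) by (simp add: ground_size_def)
  ultimately show ?thesis
    unfolding std_def shift_def[of _ "shift S \<pi>"] U
    by (auto simp: shift_def image_image intro!: image_cong)
qed

lemma disjoint_representatives:
  assumes "shuffle_compatible st" "\<tau> \<in> Psi" "\<theta> \<in> Psi"
  shows "\<exists>\<tau>'\<in>st_class Psi st \<tau>. \<exists>\<theta>'\<in>st_class Psi st \<theta>. disjoint_parts \<tau>' \<theta>'"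
proof -
  define N where "N = Suc (Max (insert 0 (\<Union>\<tau>)))"
  define S where "S = {N..<N + ground_size \<theta>}"
  have fin: "finite (\<Union>\<tau>)" using assms(2) by (simp add: Psi_def)
  have S: "finite S" "card S = ground_size \<theta>" "0 \<notin> S" by (auto simp: S_def N_def)
  have U: "\<Union>(shift S \<theta>) = S" using Union_shift[OF assms(3)] S by simp
  have "partition_on S (shift S \<theta>)"
    using partition_on_shift[of \<theta> S] assms(3) S by (simp add: Psi_def)
  then have \<theta>': "shift S \<theta> \<in> Psi" using S unfolding Psi_def mem_Collect_eq U by blast
  have "st (shift S \<theta>) = st \<theta>"
    using assms \<theta>' std_shift[OF assms(3)] S unfolding shuffle_compatible_def by blast
  moreover have "ground_size (shift S \<theta>) = ground_size \<theta>" using U S by (simp add: ground_size_def)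
  ultimately have "shift S \<theta> \<in> st_class Psi st \<theta>" using \<theta>' by (simp add: st_class_def)
  moreover have "\<tau> \<in> st_class Psi st \<tau>" using assms by (simp add: st_class_def)
  moreover have "i < N" if "i \<in> \<Union>\<tau>" for i
    using that fin Max_ge[of "insert 0 (\<Union>\<tau>)" i] by (simp add: N_def less_Suc_eq_le del: Union_iff)
  then have "disjoint_parts \<tau> (shift S \<theta>)"
    unfolding disjoint_parts_def U by (force simp: S_def simp del: Union_iff)
  ultimately show ?thesis by blast
qed

end

theory Submission
  imports Defs
begin

text \<open>Every class of \<open>st\<close> contains a standard partition, and translating the second factor does not
  change its value, so \<open>w\<^sub>\<pi> \<mapsto> [\<pi>]\<close> is a surjective algebra homomorphism from \<open>NCSym_dual\<close> onto
  \<open>A_Psi st\<close>; its kernel is the required ideal, and associativity of \<open>A_Psi st\<close> is inherited from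
  \<open>NCSym_dual\<close>. Intersecting the classes with \<open>Pi_std\<close> matches the bases and the structure
  constants of \<open>A_Psi st\<close> and \<open>A_Pi st\<close>.\<close>


section \<open>Linear extension\<close>

text \<open>The linear map determined by the images \<open>f a\<close> of the basis elements.
  Products in a \<open>based_algebra\<close> are nested instances of it, so bilinear identities
  reduce to identities on basis elements.\<close>

definition lin :: "('k \<Rightarrow> ('l \<Rightarrow>\<^sub>0 rat)) \<Rightarrow> ('k \<Rightarrow>\<^sub>0 rat) \<Rightarrow> ('l \<Rightarrow>\<^sub>0 rat)" where
  "lin f x = (\<Sum>a\<in>Poly_Mapping.keys x. scale (Poly_Mapping.lookup x a) (f a))"

lemma lookup_scale [simp]: "Poly_Mapping.lookup (scale q x) k = q * Poly_Mapping.lookup x k"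
  by (simp add: scale_def Poly_Mapping.map.rep_eq when_def)

lemma scale_add_left: "scale (p + q) x = scale p x + scale q x"
  by (rule poly_mapping_eqI) (simp add: lookup_add algebra_simps)

lemma scale_add_right: "scale q (x + y) = scale q x + scale q y"
  by (rule poly_mapping_eqI) (simp add: lookup_add algebra_simps)

lemma scale_scale: "scale p (scale q x) = scale (p * q) x"
  by (rule poly_mapping_eqI) simp

lemma scale_one [simp]: "scale 1 x = x"
  by (rule poly_mapping_eqI) simp

lemma scale_zero [simp]: "scale 0 x = 0" "scale q 0 = 0"
  by (rule poly_mapping_eqI, simp)+

lemma scale_sum: "scale q (sum f A) = (\<Sum>a\<in>A. scale q (f a))"
  by (induction A rule: infinite_finite_induct) (auto simp: scale_add_right)

lemma keys_scale: "Poly_Mapping.keys (scale q x) \<subseteq> Poly_Mapping.keys x"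
  by (auto simp: in_keys_iff)

text \<open>Coefficients outside the support vanish. A common index set is needed because
  cancellation may shrink the support of a sum, as may scaling by zero.\<close>

lemma lin_superset:
  assumes "finite A" "Poly_Mapping.keys x \<subseteq> A"
  shows "lin f x = (\<Sum>a\<in>A. scale (Poly_Mapping.lookup x a) (f a))"
  unfolding lin_def by (rule sum.mono_neutral_left) (use assms in \<open>auto simp: in_keys_iff\<close>)

lemma lin_zero [simp]: "lin f 0 = 0"
  by (simp add: lin_def)

lemma lin_add: "lin f (x + y) = lin f x + lin f y"
proof -
  let ?A = "Poly_Mapping.keys x \<union> Poly_Mapping.keys y"
  show ?thesis
    using keys_add[of x y]
    by (simp add: lin_superset[of ?A] lookup_add scale_add_left sum.distrib)
qed

lemma lin_scale: "lin f (scale q x) = scale q (lin f x)"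
  using keys_scale[of q x]
  by (simp add: lin_superset[of "Poly_Mapping.keys x"] scale_sum scale_scale)

lemma lin_sum: "lin f (sum g A) = (\<Sum>a\<in>A. lin f (g a))"
  by (induction A rule: infinite_finite_induct) (auto simp: lin_add)

lemma lin_single [simp]: "lin f (Poly_Mapping.single a q) = scale q (f a)"
  by (simp add: lin_def)

lemma lin_cong:
  "(\<And>a. a \<in> Poly_Mapping.keys x \<Longrightarrow> f a = g a) \<Longrightarrow> lin f x = lin g x"
  by (simp add: lin_def)

lemma lin_fun_add: "lin (\<lambda>a. f a + g a) x = lin f x + lin g x"
  by (simp add: lin_def scale_add_right sum.distrib)

lemma lin_fun_scale: "lin (\<lambda>a. scale q (f a)) x = scale q (lin f x)"
  by (simp add: lin_def scale_sum scale_scale mult.commute)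

lemma lin_fun_sum: "lin (\<lambda>a. \<Sum>t\<in>T. f t a) x = (\<Sum>t\<in>T. lin (f t) x)"
  unfolding lin_def scale_sum by (rule sum.swap)

lemma lin_lin: "lin g (lin f x) = lin (\<lambda>a. lin g (f a)) x"
  by (simp add: lin_def[of f] lin_sum lin_scale lin_def[of "\<lambda>a. lin g (f a)"])

text \<open>Exchange of two finite sums: a bilinear extension may be expanded in either argument
  first.\<close>

lemma lin_commute: "lin (\<lambda>a. lin (f a) y) x = lin (\<lambda>b. lin (\<lambda>a. f a b) x) y"
  unfolding lin_def scale_sum scale_scale by (subst sum.swap) (simp add: mult.commute)

lemma lin_single_id [simp]: "lin (\<lambda>a. Poly_Mapping.single a 1) x = x"
proof (rule poly_mapping_eqI)
  fix k
  have "Poly_Mapping.lookup (lin (\<lambda>a. Poly_Mapping.single a 1) x) k =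
      (\<Sum>a\<in>Poly_Mapping.keys x. if a = k then Poly_Mapping.lookup x a else 0)"
    unfolding lin_def lookup_sum by (rule sum.cong) (auto simp: lookup_single when_def)
  then show "Poly_Mapping.lookup (lin (\<lambda>a. Poly_Mapping.single a 1) x) k = Poly_Mapping.lookup x k"
    by (simp add: in_keys_iff)
qed

lemma keys_lin:
  assumes "\<And>a. a \<in> Poly_Mapping.keys x \<Longrightarrow> Poly_Mapping.keys (f a) \<subseteq> B"
  shows "Poly_Mapping.keys (lin f x) \<subseteq> B"
proof -
  have "Poly_Mapping.lookup (lin f x) k = 0" if "k \<notin> B" for k
  proof -
    have "Poly_Mapping.lookup (f a) k = 0" if "a \<in> Poly_Mapping.keys x" for a
      using assms[OF that] \<open>k \<notin> B\<close> by (auto simp: in_keys_iff)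
    then show ?thesis by (simp add: lin_def lookup_sum)
  qed
  then show ?thesis by (auto simp: in_keys_iff)
qed

section \<open>Formal sums of multisets and linear maps induced by maps of bases\<close>

lemma formal_sum_image_mset_set:
  "finite A \<Longrightarrow> formal_sum (image_mset f (mset_set A)) = (\<Sum>a\<in>A. Poly_Mapping.single (f a) 1)"
  by (simp add: formal_sum_def sum_unfold_sum_mset image_mset.compositionality comp_def)

lemma lin_formal_sum: "lin f (formal_sum M) = (\<Sum>k\<in>#M. f k)"
  unfolding formal_sum_def by (induction M) (auto simp: lin_add)

lemma keys_formal_sum: "Poly_Mapping.keys (formal_sum M) \<subseteq> set_mset M"
  unfolding formal_sum_def
proof (induction M)
  case (add a M)
  then show ?case
    using keys_add[of "Poly_Mapping.single a (1::rat)" "\<Sum>k\<in>#M. Poly_Mapping.single k 1"] by auto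
qed simp

abbreviation push :: "('k \<Rightarrow> 'l) \<Rightarrow> ('k \<Rightarrow>\<^sub>0 rat) \<Rightarrow> ('l \<Rightarrow>\<^sub>0 rat)" where
  "push f \<equiv> lin (\<lambda>a. Poly_Mapping.single (f a) 1)"

lemma push_formal_sum: "push f (formal_sum M) = formal_sum (image_mset f M)"
  by (simp add: lin_formal_sum) (simp add: formal_sum_def image_mset.compositionality comp_def)

lemma push_image:
  fixes f :: "'k \<Rightarrow> 'l"
  assumes "f ` B = C"
  shows "push f ` {x. Poly_Mapping.keys x \<subseteq> B} = {y. Poly_Mapping.keys y \<subseteq> C}"
proof (intro equalityI subsetI)
  fix y assume "y \<in> push f ` {x. Poly_Mapping.keys x \<subseteq> B}"
  then show "y \<in> {y. Poly_Mapping.keys y \<subseteq> C}"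
    using assms by (auto simp only: mem_Collect_eq intro!: keys_lin) auto
next
  fix y :: "'l \<Rightarrow>\<^sub>0 rat" assume "y \<in> {y. Poly_Mapping.keys y \<subseteq> C}"
  then have y: "c \<in> f ` B" if "c \<in> Poly_Mapping.keys y" for c using that assms by blast
  \<comment> \<open>One preimage in \<open>B\<close> is chosen for each basis element in the support
    of \<open>y\<close>.\<close>
  let ?x = "push (inv_into B f) y"
  have "push f ?x = push id y"
    unfolding lin_lin by (rule lin_cong) (use y in \<open>simp add: f_inv_into_f\<close>)
  moreover have "Poly_Mapping.keys ?x \<subseteq> B"
    by (rule keys_lin) (use y in \<open>auto intro: inv_into_into\<close>)
  ultimately show "y \<in> push f ` {x. Poly_Mapping.keys x \<subseteq> B}"
    by (intro image_eqI[of _ _ ?x]) auto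
qed

lemma push_inj:
  fixes f :: "'k \<Rightarrow> 'l"
  assumes "inj_on f B"
  shows "inj_on (push f) {x. Poly_Mapping.keys x \<subseteq> B}"
proof (rule inj_on_inverseI)
  fix x :: "'k \<Rightarrow>\<^sub>0 rat" assume "x \<in> {x. Poly_Mapping.keys x \<subseteq> B}"
  then have "push (inv_into B f) (push f x) = push id x"
    unfolding lin_lin by (intro lin_cong) (use assms in auto)
  then show "push (inv_into B f) (push f x) = x" by simp
qed

section \<open>Associative algebras\<close>

text \<open>The last equation splits the double sum of the product into two nested linear
  extensions, so that bilinearity follows from the rules for \<open>lin\<close>.\<close>

lemma based_algebra_simps:
  "carrier (based_algebra B e m) = {x. Poly_Mapping.keys x \<subseteq> B}"
  "\<one>\<^bsub>based_algebra B e m\<^esub> = Poly_Mapping.single e 1"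
  "\<zero>\<^bsub>based_algebra B e m\<^esub> = 0"
  "x \<oplus>\<^bsub>based_algebra B e m\<^esub> y = x + y"
  "q \<odot>\<^bsub>based_algebra B e m\<^esub> x = scale q x"
  "x \<otimes>\<^bsub>based_algebra B e m\<^esub> y = lin (\<lambda>a. lin (m a) y) x"
  by (simp_all add: based_algebra_def lin_def scale_sum scale_scale)

lemma Q_field_simps:
  "carrier Q_field = UNIV" "\<one>\<^bsub>Q_field\<^esub> = 1" "p \<oplus>\<^bsub>Q_field\<^esub> q = p + q" "p \<otimes>\<^bsub>Q_field\<^esub> q = p * q"
  by (simp_all add: ring_of_type_algebra_def)

text \<open>By multilinearity the unit laws and associativity need only be known on basis elements.
  In \<open>assoc\<close> the products \<open>m a b\<close> and \<open>m b c\<close> are themselves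
  linear combinations, hence the outer \<open>lin\<close>.\<close>

lemma assoc_algebra_based_algebra:
  fixes m :: "'k \<Rightarrow> 'k \<Rightarrow> ('k \<Rightarrow>\<^sub>0 rat)"
  assumes e: "e \<in> B"
    and closed: "\<And>a b. a \<in> B \<Longrightarrow> b \<in> B \<Longrightarrow> Poly_Mapping.keys (m a b) \<subseteq> B"
    and unit: "\<And>a. a \<in> B \<Longrightarrow> m e a = Poly_Mapping.single a 1"
      "\<And>a. a \<in> B \<Longrightarrow> m a e = Poly_Mapping.single a 1"
    and assoc: "\<And>a b c. a \<in> B \<Longrightarrow> b \<in> B \<Longrightarrow> c \<in> B \<Longrightarrow>
      lin (\<lambda>d. m d c) (m a b) = lin (m a) (m b c)"
  shows "assoc_algebra Q_field (based_algebra B e m)"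
proof -
  let ?A = "based_algebra B e m"
  have ag: "abelian_group ?A"
  proof (rule abelian_groupI, unfold based_algebra_simps)
    fix x :: "'k \<Rightarrow>\<^sub>0 rat" assume "x \<in> {x. Poly_Mapping.keys x \<subseteq> B}"
    then show "\<exists>y\<in>{x. Poly_Mapping.keys x \<subseteq> B}. y + x = 0" by (intro bexI[of _ "- x"]) auto
  qed (auto simp: algebra_simps dest: keys_add[THEN subsetD])
  have mon: "monoid ?A"
  proof (rule monoidI, unfold based_algebra_simps)
    fix x y z :: "'k \<Rightarrow>\<^sub>0 rat"
    assume x: "x \<in> {x. Poly_Mapping.keys x \<subseteq> B}"
    then show "lin (\<lambda>a. lin (m a) x) (Poly_Mapping.single e 1) = x"
      using lin_cong[of x "m e" "\<lambda>a. Poly_Mapping.single a 1"] unit by auto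
    show "lin (\<lambda>a. lin (m a) (Poly_Mapping.single e 1)) x = x"
      using lin_cong[of x "\<lambda>a. m a e" "\<lambda>a. Poly_Mapping.single a 1"] unit x by auto
    assume y: "y \<in> {x. Poly_Mapping.keys x \<subseteq> B}"
    with x show "lin (\<lambda>a. lin (m a) y) x \<in> {x. Poly_Mapping.keys x \<subseteq> B}"
      unfolding mem_Collect_eq by (intro keys_lin closed) auto
    assume z: "z \<in> {x. Poly_Mapping.keys x \<subseteq> B}"
    show "lin (\<lambda>a. lin (m a) z) (lin (\<lambda>a. lin (m a) y) x) =
        lin (\<lambda>a. lin (m a) (lin (\<lambda>a. lin (m a) z) y)) x"
      unfolding lin_lin
    proof (intro lin_cong)
      fix a b assume "a \<in> Poly_Mapping.keys x" "b \<in> Poly_Mapping.keys y"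
      \<comment> \<open>For fixed \<open>a\<close> and \<open>b\<close>, associativity on basis
        elements is summed over the support of \<open>z\<close>; \<open>lin_commute\<close> then
        puts the sum over \<open>m a b\<close> outside.\<close>
      then have "lin (\<lambda>c. lin (\<lambda>d. m d c) (m a b)) z = lin (\<lambda>c. lin (m a) (m b c)) z"
        using x y z by (intro lin_cong assoc) auto
      then show "lin (\<lambda>d. lin (m d) z) (m a b) = lin (\<lambda>c. lin (m a) (m b c)) z"
        by (simp add: lin_commute[of m])
    qed
  qed (use e in auto)
  have "ring ?A"
    by (rule ringI[OF ag mon]) (simp_all add: based_algebra_simps lin_add lin_fun_add)
  moreover have "module Q_field ?A"
    by (rule moduleI[OF cring_from_type_algebra ag])
      (auto simp: based_algebra_simps Q_field_simps scale_add_left scale_add_right scale_scale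
        dest: keys_scale[THEN subsetD])
  ultimately show ?thesis
    by (simp add: assoc_algebra_def based_algebra_simps lin_scale lin_fun_scale)
qed

section \<open>Homomorphic images, quotients and the first isomorphism theorem\<close>

text \<open>Every element of \<open>B\<close> has the form \<open>h x\<close>, so each axiom for
  \<open>B\<close> is the image of the same axiom for \<open>A\<close>. As \<open>B\<close> is only
  shown to be a ring here, preservation of zero, on which \<open>ring_hom\<close> is silent, is a
  separate hypothesis.\<close>

lemma assoc_algebra_hom_image:
  assumes A: "assoc_algebra R A"
    and h: "h \<in> ring_hom A B" "h ` carrier A = carrier B" "h \<zero>\<^bsub>A\<^esub> = \<zero>\<^bsub>B\<^esub>"
    and smult: "\<And>q x. q \<in> carrier R \<Longrightarrow> x \<in> carrier A \<Longrightarrow> h (q \<odot>\<^bsub>A\<^esub> x) = q \<odot>\<^bsub>B\<^esub> h x"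
  shows "assoc_algebra R B"
proof -
  interpret A: ring A using A by (simp add: assoc_algebra_def)
  interpret M: module R A using A by (simp add: assoc_algebra_def)
  have Amul: "(q \<odot>\<^bsub>A\<^esub> x) \<otimes>\<^bsub>A\<^esub> y = q \<odot>\<^bsub>A\<^esub> (x \<otimes>\<^bsub>A\<^esub> y)" "x \<otimes>\<^bsub>A\<^esub> (q \<odot>\<^bsub>A\<^esub> y) = q \<odot>\<^bsub>A\<^esub> (x \<otimes>\<^bsub>A\<^esub> y)"
    if "q \<in> carrier R" "x \<in> carrier A" "y \<in> carrier A" for q x y
    using A that by (auto simp: assoc_algebra_def)
  have lift: "\<exists>x\<in>carrier A. y = h x" if "y \<in> carrier B" for y
    using that h(2) by blast
  \<comment> \<open>Oriented so that an operation of \<open>B\<close> on images becomes the image of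
    an operation of \<open>A\<close>.\<close>
  note pull = ring_hom_memE(2,3)[OF h(1), symmetric] ring_hom_memE(4)[OF h(1), symmetric]
    h(3)[symmetric] smult[symmetric] ring_hom_memE(1)[OF h(1)]
  have ag: "abelian_group B"
  proof (rule abelian_groupI)
    fix x assume "x \<in> carrier B"
    then obtain a where a: "a \<in> carrier A" "x = h a" using lift by blast
    then have "h (\<ominus>\<^bsub>A\<^esub> a) \<oplus>\<^bsub>B\<^esub> x = \<zero>\<^bsub>B\<^esub>" by (simp add: pull A.l_neg)
    with a show "\<exists>y\<in>carrier B. y \<oplus>\<^bsub>B\<^esub> x = \<zero>\<^bsub>B\<^esub>" using ring_hom_memE(1)[OF h(1)] by blast
  qed (auto dest!: lift simp: pull A.a_ac)
  have "monoid B"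
    by (rule monoidI) (auto dest!: lift simp: pull A.m_assoc)
  then have "ring B"
    by (rule ringI[OF ag]) (auto dest!: lift simp: pull A.l_distr A.r_distr)
  moreover have "module R B"
    by (rule moduleI[OF M.is_cring ag])
      (auto dest!: lift simp: pull M.smult_l_distr M.smult_r_distr M.smult_assoc1)
  moreover have "(q \<odot>\<^bsub>B\<^esub> x) \<otimes>\<^bsub>B\<^esub> y = q \<odot>\<^bsub>B\<^esub> (x \<otimes>\<^bsub>B\<^esub> y) \<and> x \<otimes>\<^bsub>B\<^esub> (q \<odot>\<^bsub>B\<^esub> y) = q \<odot>\<^bsub>B\<^esub> (x \<otimes>\<^bsub>B\<^esub> y)"
    if "q \<in> carrier R" "x \<in> carrier B" "y \<in> carrier B" for q x y
    using that by (auto dest!: lift simp: pull Amul)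
  ultimately show ?thesis by (simp add: assoc_algebra_def)
qed

lemma quot_algebra_simps:
  "carrier (quot_algebra A I) = carrier (A Quot I)"
  "\<one>\<^bsub>quot_algebra A I\<^esub> = \<one>\<^bsub>A Quot I\<^esub>"
  "\<zero>\<^bsub>quot_algebra A I\<^esub> = \<zero>\<^bsub>A Quot I\<^esub>"
  "x \<oplus>\<^bsub>quot_algebra A I\<^esub> y = x \<oplus>\<^bsub>A Quot I\<^esub> y"
  "x \<otimes>\<^bsub>quot_algebra A I\<^esub> y = x \<otimes>\<^bsub>A Quot I\<^esub> y"
  "q \<odot>\<^bsub>quot_algebra A I\<^esub> C = (\<Union>x\<in>C. I +>\<^bsub>A\<^esub> (q \<odot>\<^bsub>A\<^esub> x))"
  by (simp_all add: quot_algebra_def)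

text \<open>\<open>I\<close> is closed under scalars, so scaling any member of a coset gives the
  same coset, and the union in \<open>quot_algebra\<close> collapses to it.\<close>

lemma quot_algebra_smult:
  assumes A: "assoc_algebra R A" and "ideal I A" and q: "q \<in> carrier R" and x: "x \<in> carrier A"
  shows "q \<odot>\<^bsub>quot_algebra A I\<^esub> (I +>\<^bsub>A\<^esub> x) = I +>\<^bsub>A\<^esub> (q \<odot>\<^bsub>A\<^esub> x)"
proof -
  interpret M: module R A using A by (simp add: assoc_algebra_def)
  interpret I: ideal I A by fact
  have "I +>\<^bsub>A\<^esub> (q \<odot>\<^bsub>A\<^esub> y) = I +>\<^bsub>A\<^esub> (q \<odot>\<^bsub>A\<^esub> x)" if y: "y \<in> I +>\<^bsub>A\<^esub> x" for y
  proof -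
    obtain i where i: "i \<in> I" "y = i \<oplus>\<^bsub>A\<^esub> x" using y by (auto simp: a_r_coset_def')
    then have iA: "i \<in> carrier A" using I.Icarr by blast
    \<comment> \<open>Scaling is left multiplication by \<open>q\<close> times the unit, which
      \<open>I\<close> absorbs.\<close>
    have "q \<odot>\<^bsub>A\<^esub> i = q \<odot>\<^bsub>A\<^esub> (\<one>\<^bsub>A\<^esub> \<otimes>\<^bsub>A\<^esub> i)" using iA by simp
    also have "\<dots> = (q \<odot>\<^bsub>A\<^esub> \<one>\<^bsub>A\<^esub>) \<otimes>\<^bsub>A\<^esub> i"
      using A q iA by (simp add: assoc_algebra_def)
    also have "\<dots> \<in> I" using i(1) q by (intro I.I_l_closed) auto
    finally have "q \<odot>\<^bsub>A\<^esub> i \<in> I" .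
    moreover have "q \<odot>\<^bsub>A\<^esub> y = q \<odot>\<^bsub>A\<^esub> i \<oplus>\<^bsub>A\<^esub> q \<odot>\<^bsub>A\<^esub> x"
      using i iA q x by (simp add: M.smult_r_distr)
    ultimately have "q \<odot>\<^bsub>A\<^esub> y \<in> I +>\<^bsub>A\<^esub> (q \<odot>\<^bsub>A\<^esub> x)" by (auto simp: a_r_coset_def')
    then show ?thesis
      by (rule M.a_repr_independence[OF _ M.smult_closed[OF q x] I.a_subgroup, symmetric])
  qed
  \<comment> \<open>A union over an empty index set would be empty rather than the common
    coset.\<close>
  moreover have "I +>\<^bsub>A\<^esub> x \<noteq> {}" using I.a_rcos_self[OF x] by blast
  ultimately show ?thesis unfolding quot_algebra_simps by (intro SUP_eq_const)
qed

lemma assoc_algebra_quot: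
  assumes A: "assoc_algebra R A" and "ideal I A"
  shows "assoc_algebra R (quot_algebra A I)"
proof (rule assoc_algebra_hom_image[OF A, of "(+>\<^bsub>A\<^esub>) I"])
  interpret I: ideal I A by fact
  show "(+>\<^bsub>A\<^esub>) I \<in> ring_hom A (quot_algebra A I)"
    using I.rcos_ring_hom by (simp add: ring_hom_def quot_algebra_simps)
  show "(+>\<^bsub>A\<^esub>) I ` carrier A = carrier (quot_algebra A I)"
    by (auto simp: quot_algebra_simps FactRing_def A_RCOSETS_def')
  show "I +>\<^bsub>A\<^esub> \<zero>\<^bsub>A\<^esub> = \<zero>\<^bsub>quot_algebra A I\<^esub>"
    by (simp add: quot_algebra_simps FactRing_def I.a_subset)
qed (simp add: quot_algebra_smult[OF assms])

text \<open>The ideal is the kernel of \<open>h\<close>. The induced ring isomorphism is inverted,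
  and compatibility with scalars is read off from its values on the images
  \<open>h x\<close>.\<close>

lemma first_isomorphism:
  assumes A: "assoc_algebra R A"
    and h: "h \<in> ring_hom A B" "h ` carrier A = carrier B" "h \<zero>\<^bsub>A\<^esub> = \<zero>\<^bsub>B\<^esub>"
    and smult: "\<And>q x. q \<in> carrier R \<Longrightarrow> x \<in> carrier A \<Longrightarrow> h (q \<odot>\<^bsub>A\<^esub> x) = q \<odot>\<^bsub>B\<^esub> h x"
  shows "\<exists>I. ideal I A \<and> algebra_isomorphic R B (quot_algebra A I)"
proof -
  have B: "assoc_algebra R B" by (rule assoc_algebra_hom_image[OF assms])
  interpret M: module R A using A by (simp add: assoc_algebra_def)
  interpret h: ring_hom_ring A B h
    using A B h(1) by (intro ring_hom_ringI2) (simp_all add: assoc_algebra_def)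
  define K where "K = a_kernel A B h"
  interpret K: ideal K A unfolding K_def by (rule h.kernel_is_ideal)
  \<comment> \<open>\<open>the_elem\<close> picks the common value of \<open>h\<close> on a coset of
    the kernel; the inverse is taken because the required isomorphism starts at
    \<open>B\<close>.\<close>
  define g where "g = inv_into (carrier (A Quot K)) (\<lambda>C. the_elem (h ` C))"
  have iso: "(\<lambda>C. the_elem (h ` C)) \<in> ring_iso (A Quot K) B"
    unfolding K_def by (rule h.FactRing_iso_set[OF h(2)])
  then have inj: "inj_on (\<lambda>C. the_elem (h ` C)) (carrier (A Quot K))"
    by (simp add: ring_iso_def bij_betw_def)
  have g: "g \<in> ring_iso B (A Quot K)"
    unfolding g_def by (rule ring_iso_set_sym[OF K.quotient_is_ring iso])
  have g_h: "g (h x) = K +>\<^bsub>A\<^esub> x" if "x \<in> carrier A" for x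
  proof -
    have "K +>\<^bsub>A\<^esub> x \<in> carrier (A Quot K)"
      using that by (auto simp: FactRing_def A_RCOSETS_def')
    moreover have "h x = the_elem (h ` (K +>\<^bsub>A\<^esub> x))"
      using that unfolding K_def by simp
    ultimately show ?thesis
      unfolding g_def using inv_into_f_f[OF inj] by metis
  qed
  have "g (q \<odot>\<^bsub>B\<^esub> y) = q \<odot>\<^bsub>quot_algebra A K\<^esub> g y"
    if q: "q \<in> carrier R" and y: "y \<in> carrier B" for q y
  proof -
    obtain x where x: "x \<in> carrier A" "y = h x" using y h(2) by blast
    then have "g (q \<odot>\<^bsub>B\<^esub> y) = g (h (q \<odot>\<^bsub>A\<^esub> x))" using smult q by simp
    then show ?thesis
      using x q by (simp add: g_h quot_algebra_smult[OF A K.ideal_axioms])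
  qed
  moreover have "g \<in> ring_iso B (quot_algebra A K)"
    using g by (simp add: ring_iso_def ring_hom_def quot_algebra_simps)
  ultimately have "g \<in> algebra_iso R B (quot_algebra A K)" by (simp add: algebra_iso_def)
  then have "algebra_isomorphic R B (quot_algebra A K)"
    using B assoc_algebra_quot[OF A K.ideal_axioms] by (auto simp: algebra_isomorphic_def)
  then show ?thesis using K.ideal_axioms by blast
qed

text \<open>Both products are bilinear, so compatibility with the products of basis elements
  suffices.\<close>

lemma push_ring_hom:
  fixes f :: "'k \<Rightarrow> 'l"
  assumes "f ` B \<subseteq> C" "f e = e'"
    and mult: "\<And>a b. a \<in> B \<Longrightarrow> b \<in> B \<Longrightarrow> m' (f a) (f b) = push f (m a b)"
  shows "push f \<in> ring_hom (based_algebra B e m) (based_algebra C e' m')"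
proof (rule ring_hom_memI, unfold based_algebra_simps)
  fix x y :: "'k \<Rightarrow>\<^sub>0 rat"
  assume x: "x \<in> {x. Poly_Mapping.keys x \<subseteq> B}"
  then show "push f x \<in> {y. Poly_Mapping.keys y \<subseteq> C}"
    using assms(1) unfolding mem_Collect_eq by (intro keys_lin) auto
  assume y: "y \<in> {x. Poly_Mapping.keys x \<subseteq> B}"
  show "push f (lin (\<lambda>a. lin (m a) y) x) = lin (\<lambda>a. lin (m' a) (push f y)) (push f x)"
    unfolding lin_lin lin_single scale_one
  proof (intro lin_cong)
    fix a b assume "a \<in> Poly_Mapping.keys x" "b \<in> Poly_Mapping.keys y"
    then have "a \<in> B" "b \<in> B" using x y by auto
    then show "push f (m a b) = m' (f a) (f b)" using mult by simp
  qed
  show "push f (x + y) = push f x + push f y" by (rule lin_add)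
qed (use assms in simp)


section \<open>Associativity of the shifted arc-shuffle\<close>

lemma relabel_strict_mono:
  assumes "finite I" "finite S" "card S = card I"
  shows "strict_mono_on I (relabel I S)"
proof (rule strict_mono_onI)
  fix a b assume ab: "a \<in> I" "b \<in> I" "a < b"
  then have "card {j \<in> I. j < a} < card {j \<in> I. j < b}"
    using assms(1) by (intro psubset_card_mono) auto
  moreover have "card {j \<in> I. j < b} < card I"
    using assms(1) ab by (intro psubset_card_mono) auto
  ultimately show "relabel I S a < relabel I S b"
    unfolding relabel_def using assms strict_sorted_list_of_set[of S]
    by (intro sorted_wrt_nth_less[of "(<)"]) auto
qed

text \<open>\<open>relabel\<close> preserves the rank of an element, and the rank is injective on
  \<open>V\<close>.\<close>

lemma relabel_self:
  assumes "finite V" "i \<in> V"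
  shows "relabel V V i = i"
proof -
  have "relabel V V i \<in> V"
    using relabel_bij[of V V] assms by (auto simp: bij_betw_def)
  then show ?thesis
    using rank_relabel[of V V i] rank_bij[of V] assms by (auto simp: bij_betw_def dest: inj_onD)
qed

text \<open>A finite set has only one strictly increasing enumeration, and mapping \<open>f\<close>
  over that of \<open>S\<close> gives one for the image.\<close>

lemma sorted_list_of_set_image:
  fixes f :: "nat \<Rightarrow> nat"
  assumes "finite S" "strict_mono_on S f"
  shows "sorted_list_of_set (f ` S) = map f (sorted_list_of_set S)"
proof -
  have "sorted_wrt (<) (map f (sorted_list_of_set S))"
    unfolding sorted_wrt_map
    by (rule sorted_wrt_mono_rel[OF _ strict_sorted_list_of_set])
      (use assms in \<open>auto simp: strict_mono_on_def\<close>)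
  moreover have "card (f ` S) = card S"
    using assms strict_mono_on_imp_inj_on card_image by blast
  ultimately have "sorted_wrt (<) (map f (sorted_list_of_set S)) \<and>
      set (map f (sorted_list_of_set S)) = f ` S \<and> length (map f (sorted_list_of_set S)) = card (f ` S)"
    using assms by simp
  then show ?thesis
    using sorted_list_of_set_unique[of "f ` S" "map f (sorted_list_of_set S)"] assms(1) by simp
qed

text \<open>An increasing \<open>f\<close> sends the element of \<open>S\<close> at a given position
  to the element of its image at the same position.\<close>

lemma shift_image:
  assumes "\<pi> \<in> Psi" "finite S" "card S = ground_size \<pi>" "strict_mono_on S f"
  shows "(`) f ` shift S \<pi> = shift (f ` S) \<pi>"
proof -
  let ?I = "\<Union>\<pi>"
  have fin: "finite ?I" using assms by (simp add: Psi_def)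
  have "f (relabel ?I S i) = relabel ?I (f ` S) i" if i: "i \<in> ?I" for i
  proof -
    have "{j \<in> ?I. j < i} \<subset> ?I" using i by blast
    then have "card {j \<in> ?I. j < i} < card S"
      using psubset_card_mono[OF fin] assms(3) by (simp add: ground_size_def)
    then show ?thesis
      using assms by (simp add: relabel_def sorted_list_of_set_image)
  qed
  then have "f ` relabel ?I S ` B = relabel ?I (f ` S) ` B" if "B \<in> \<pi>" for B
    using that by (force simp: image_image intro!: image_cong)
  then show ?thesis by (auto simp: shift_def image_image intro!: image_cong)
qed

text \<open>Relabelling depends only on ranks within the ground set, and translation preserves
  these.\<close>

lemma shift_translate: "shift S (translate n \<theta>) = shift S \<theta>"
proof -
  have "{j \<in> (\<lambda>i. i + n) ` \<Union>\<theta>. j < i + n} = (\<lambda>i. i + n) ` {j \<in> \<Union>\<theta>. j < i}" for i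
    by (auto simp del: Union_iff)
  then have "relabel ((\<lambda>i. i + n) ` \<Union>\<theta>) S (i + n) = relabel (\<Union>\<theta>) S i" for i
    by (simp add: relabel_def card_image)
  then show ?thesis
    unfolding shift_def Union_translate by (simp add: translate_def image_image)
qed

lemma std_translate: "std (translate n \<theta>) = std \<theta>"
  by (simp add: std_def ground_size_translate shift_translate)

lemma shift_empty [simp]: "shift S {} = {}"
  by (simp add: shift_def)

lemma shift_Pi_std:
  assumes "\<pi> \<in> Pi_std"
  shows "shift {1..ground_size \<pi>} \<pi> = \<pi>"
proof -
  have "relabel (\<Union>\<pi>) (\<Union>\<pi>) ` B = B" if "B \<in> \<pi>" for B
  proof -
    have "finite (\<Union>\<pi>)" using Pi_std_imp_Psi[OF assms] by (simp add: Psi_def)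
    then have "relabel (\<Union>\<pi>) (\<Union>\<pi>) i = i" if "i \<in> B" for i
      using \<open>B \<in> \<pi>\<close> that by (intro relabel_self) auto
    then show ?thesis by simp
  qed
  then have "shift (\<Union>\<pi>) \<pi> = \<pi>" by (simp add: shift_def)
  then show ?thesis using Pi_std_Union[OF assms] by simp
qed

section \<open>Sums over subsets of fixed size and the product of basis elements\<close>

abbreviation subsets_of_card :: "nat set \<Rightarrow> nat \<Rightarrow> nat set set" where
  "subsets_of_card U n \<equiv> {S. S \<subseteq> U \<and> card S = n}"

text \<open>Injective maps preserve cardinality. This reindexes sums over subsets when the ground
  set changes.\<close>

lemma bij_betw_subsets_of_card:
  assumes "bij_betw f A B"
  shows "bij_betw ((`) f) (subsets_of_card A n) (subsets_of_card B n)"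
proof (rule bij_betw_subset[OF bij_betw_Pow[OF assms]])
  have card: "card (f ` S) = card S" if "S \<subseteq> A" for S
    using assms that by (meson bij_betw_imp_inj_on card_image inj_on_subset)
  show "(`) f ` subsets_of_card A n = subsets_of_card B n"
  proof (intro equalityI subsetI)
    fix S assume S: "S \<in> subsets_of_card B n"
    then have "S \<in> (`) f ` Pow A" using bij_betw_Pow[OF assms] by (auto simp: bij_betw_def)
    then obtain R where "R \<subseteq> A" "S = f ` R" by auto
    then show "S \<in> (`) f ` subsets_of_card A n" using S card by auto
  next
    fix S assume "S \<in> (`) f ` subsets_of_card A n"
    then show "S \<in> subsets_of_card B n" using assms card by (auto simp: bij_betw_def)
  qed
qed auto

definition w_mult :: "setpart \<Rightarrow> setpart \<Rightarrow> (setpart \<Rightarrow>\<^sub>0 rat)" where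
  "w_mult \<tau> \<theta> = formal_sum (ASh_shifted \<tau> \<theta>)"

text \<open>Translation places the second factor right after the first, so the common ground set is
  the interval \<open>U\<close>; the translation then disappears from the summands by
  \<open>shift_translate\<close>.\<close>

lemma w_mult_eq:
  assumes "\<tau> \<in> Pi_std" "\<theta> \<in> Pi_std"
  defines "U \<equiv> {1..ground_size \<tau> + ground_size \<theta>}"
  shows "w_mult \<tau> \<theta> = (\<Sum>S\<in>subsets_of_card U (ground_size \<tau>).
    Poly_Mapping.single (shift S \<tau> \<union> shift (U - S) \<theta>) 1)"
proof -
  have "\<Union>\<tau> \<union> \<Union>(translate (ground_size \<tau>) \<theta>) = {1..ground_size \<tau>} \<union> (\<lambda>i. i + ground_size \<tau>) ` {1..ground_size \<theta>}"
    by (simp only: Union_translate Pi_std_Union[OF assms(1)] Pi_std_Union[OF assms(2)])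
  also have "\<dots> = U"
    unfolding image_add_atLeastAtMost' U_def by auto
  finally have "\<Union>\<tau> \<union> \<Union>(translate (ground_size \<tau>) \<theta>) = U" .
  then show ?thesis
    unfolding w_mult_def ASh_shifted_def ASh_def
    by (simp add: formal_sum_image_mset_set shift_translate U_def)
qed

lemma keys_w_mult:
  assumes "\<tau> \<in> Pi_std" "\<theta> \<in> Pi_std" "\<pi> \<in> Poly_Mapping.keys (w_mult \<tau> \<theta>)"
  shows "\<pi> \<in> Pi_std" "ground_size \<pi> = ground_size \<tau> + ground_size \<theta>"
  using keys_formal_sum[of "ASh_shifted \<tau> \<theta>"] ASh_shifted_Pi[of \<tau> \<theta> \<pi>] assms
  by (auto simp: w_mult_def)

text \<open>Since relabelling along the increasing bijection commutes with arc-shuffles, a product of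
  basis elements can be transported to an arbitrary ground set \<open>U\<close>.\<close>

lemma lin_shift_w_mult:
  assumes "\<tau> \<in> Pi_std" "\<theta> \<in> Pi_std" "finite U" "card U = ground_size \<tau> + ground_size \<theta>"
  shows "lin (\<lambda>\<pi>. G (shift U \<pi>)) (w_mult \<tau> \<theta>) =
    (\<Sum>S\<in>subsets_of_card U (ground_size \<tau>). G (shift S \<tau> \<union> shift (U - S) \<theta>))"
proof -
  define V where "V = {1..ground_size \<tau> + ground_size \<theta>}"
  define r where "r = relabel V U"
  have V: "finite V" "card U = card V" using assms by (auto simp: V_def)
  have r: "bij_betw r V U" "strict_mono_on V r"
    using V assms relabel_bij relabel_strict_mono by (auto simp: r_def)
  have "shift U (shift S \<tau> \<union> shift (V - S) \<theta>) = shift (r ` S) \<tau> \<union> shift (U - r ` S) \<theta>"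
    if S: "S \<in> subsets_of_card V (ground_size \<tau>)" for S
  proof -
    have finS: "finite S" using S V finite_subset by blast
    have c: "card (V - S) = ground_size \<theta>"
      using S finS by (simp add: card_Diff_subset) (simp add: V_def)
    \<comment> \<open>Since the ground set is \<open>V\<close>, the outer \<open>shift U\<close>
      applies \<open>r\<close> to every block and distributes over the union.\<close>
    have "\<Union>(shift S \<tau> \<union> shift (V - S) \<theta>) = V"
      using S finS V c assms(1,2) Union_shift[of \<tau> S] Union_shift[of \<theta> "V - S"] Pi_std_imp_Psi by auto
    then have "shift U (shift S \<tau> \<union> shift (V - S) \<theta>) = (`) r ` shift S \<tau> \<union> (`) r ` shift (V - S) \<theta>"
      unfolding shift_def[of U] r_def by (simp add: image_Un)
    also have "\<dots> = shift (r ` S) \<tau> \<union> shift (r ` (V - S)) \<theta>"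
      using S finS V c assms(1,2) Pi_std_imp_Psi r(2)
      by (subst (1 2) shift_image) (auto intro: monotone_on_subset)
    also have "r ` (V - S) = U - r ` S"
      using r(1) S by (auto simp: bij_betw_def dest: inj_onD)
    finally show ?thesis .
  qed
  then have "lin (\<lambda>\<pi>. G (shift U \<pi>)) (w_mult \<tau> \<theta>) =
      (\<Sum>S\<in>subsets_of_card V (ground_size \<tau>). G (shift (r ` S) \<tau> \<union> shift (U - r ` S) \<theta>))"
    unfolding w_mult_eq[OF assms(1,2), folded V_def] by (simp add: lin_sum)
  \<comment> \<open>Subsets of \<open>V\<close> are traded for their images under the bijection
    \<open>r\<close>.\<close>
  also have "\<dots> = (\<Sum>S\<in>subsets_of_card U (ground_size \<tau>). G (shift S \<tau> \<union> shift (U - S) \<theta>))"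
    by (rule sum.reindex_bij_betw[OF bij_betw_subsets_of_card[OF r(1)]])
  finally show ?thesis .
qed

text \<open>Both iterated products are sums over the ordered decompositions of the ground set into
  three parts.\<close>

lemma w_mult_assoc:
  assumes "\<tau> \<in> Pi_std" "\<theta> \<in> Pi_std" "\<sigma> \<in> Pi_std"
  shows "lin (\<lambda>\<pi>. w_mult \<pi> \<sigma>) (w_mult \<tau> \<theta>) = lin (w_mult \<tau>) (w_mult \<theta> \<sigma>)"
proof -
  let ?n = "ground_size \<tau>" and ?m = "ground_size \<theta>" and ?k = "ground_size \<sigma>"
  define W where "W = {1..?n + ?m + ?k}"
  \<comment> \<open>The term of a decomposition of \<open>W\<close> into \<open>S\<close>,
    \<open>R\<close>, \<open>T\<close>, which carry \<open>\<tau>\<close>, \<open>\<theta>\<close>,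
    \<open>\<sigma>\<close> respectively.\<close>
  define F :: "nat set \<Rightarrow> nat set \<Rightarrow> nat set \<Rightarrow> (setpart \<Rightarrow>\<^sub>0 rat)" where
    "F = (\<lambda>S R T. Poly_Mapping.single (shift S \<tau> \<union> shift R \<theta> \<union> shift T \<sigma>) 1)"
  have W: "finite W" "card W = ?n + ?m + ?k" by (auto simp: W_def)
  have finsub: "finite S" if "S \<subseteq> W" for S using that W finite_subset by blast
  have cardD: "card (A - B) = card A - card B" if "B \<subseteq> A" "A \<subseteq> W" for A B
    using that finsub by (meson card_Diff_subset order_trans)
  \<comment> \<open>All partitions in the support of \<open>w_mult \<tau> \<theta>\<close> have the
    same size, so the range of \<open>T\<close> does not depend on \<open>\<pi>\<close>.\<close>
  have "lin (\<lambda>\<pi>. w_mult \<pi> \<sigma>) (w_mult \<tau> \<theta>) =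
      lin (\<lambda>\<pi>. \<Sum>T\<in>subsets_of_card W (?n + ?m).
        Poly_Mapping.single (shift T \<pi> \<union> shift (W - T) \<sigma>) 1) (w_mult \<tau> \<theta>)"
    by (rule lin_cong)
      (use keys_w_mult[OF assms(1,2)] assms(3) in \<open>simp add: w_mult_eq W_def\<close>)
  \<comment> \<open>The inner product is transported to the ground set \<open>T\<close>, with
    \<open>G\<close> adjoining the fixed part on \<open>W - T\<close>.\<close>
  also have "\<dots> = (\<Sum>T\<in>subsets_of_card W (?n + ?m). \<Sum>S\<in>subsets_of_card T ?n. F S (T - S) (W - T))"
    unfolding lin_fun_sum F_def
    by (intro sum.cong refl)
      (use finsub in \<open>simp add: lin_shift_w_mult[OF assms(1,2), where G = "\<lambda>\<rho>. Poly_Mapping.single (\<rho> \<union> _) 1"]\<close>)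
  also have "\<dots> = (\<Sum>(T, S)\<in>(SIGMA T:subsets_of_card W (?n + ?m). subsets_of_card T ?n). F S (T - S) (W - T))"
    by (rule sum.Sigma) (use W finsub in auto)
  \<comment> \<open>A pair with \<open>S\<close> inside \<open>T\<close> corresponds to the disjoint
    pair \<open>S\<close>, \<open>R = T - S\<close>; the third part is the remainder in both
    descriptions.\<close>
  also have "\<dots> = (\<Sum>(S, R)\<in>(SIGMA S:subsets_of_card W ?n. subsets_of_card (W - S) ?m). F S R (W - S - R))"
  proof (rule sum.reindex_bij_witness[where i = "\<lambda>(S, R). (S \<union> R, S)" and j = "\<lambda>(T, S). (S, T - S)"])
    fix p assume p: "p \<in> (SIGMA S:subsets_of_card W ?n. subsets_of_card (W - S) ?m)"
    then obtain S R where SR: "p = (S, R)" "S \<subseteq> W" "card S = ?n" "R \<subseteq> W - S" "card R = ?m" by auto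
    then have "finite S" "finite R" using finsub by blast+
    moreover have "S \<inter> R = {}" using SR by auto
    ultimately have "card (S \<union> R) = ?n + ?m" using SR by (simp add: card_Un_disjoint)
    then show "(case p of (S, R) \<Rightarrow> (S \<union> R, S)) \<in> (SIGMA T:subsets_of_card W (?n + ?m). subsets_of_card T ?n)"
      using SR by auto
    show "(case case p of (S, R) \<Rightarrow> (S \<union> R, S) of (T, S) \<Rightarrow> (S, T - S)) = p"
      using SR by auto
  next
    fix p assume p: "p \<in> (SIGMA T:subsets_of_card W (?n + ?m). subsets_of_card T ?n)"
    then obtain T S where TS: "p = (T, S)" "T \<subseteq> W" "card T = ?n + ?m" "S \<subseteq> T" "card S = ?n" by auto
    show "(case p of (T, S) \<Rightarrow> (S, T - S)) \<in> (SIGMA S:subsets_of_card W ?n. subsets_of_card (W - S) ?m)"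
      using TS cardD by auto
    show "(case case p of (T, S) \<Rightarrow> (S, T - S) of (S, R) \<Rightarrow> (S \<union> R, S)) = p"
      using TS by auto
    have "W - S - (T - S) = W - T" using TS by auto
    then show "(case case p of (T, S) \<Rightarrow> (S, T - S) of (S, R) \<Rightarrow> F S R (W - S - R)) =
        (case p of (T, S) \<Rightarrow> F S (T - S) (W - T))"
      using TS by simp
  qed
  also have "\<dots> = (\<Sum>S\<in>subsets_of_card W ?n. \<Sum>R\<in>subsets_of_card (W - S) ?m. F S R (W - S - R))"
    by (rule sum.Sigma[symmetric]) (use W in auto)
  \<comment> \<open>The roles are now reversed: \<open>G\<close> adjoins the fixed part on
    \<open>S\<close>, and the product of \<open>\<theta>\<close> and \<open>\<sigma>\<close> lives
    on \<open>W - S\<close>.\<close>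
  also have "\<dots> = lin (\<lambda>\<pi>. \<Sum>S\<in>subsets_of_card W ?n.
        Poly_Mapping.single (shift S \<tau> \<union> shift (W - S) \<pi>) 1) (w_mult \<theta> \<sigma>)"
    unfolding lin_fun_sum F_def Un_assoc
    by (intro sum.cong refl)
      (use W cardD in \<open>simp add: lin_shift_w_mult[OF assms(2,3), where G = "\<lambda>\<rho>. Poly_Mapping.single (_ \<union> \<rho>) 1"]\<close>)
  also have "\<dots> = lin (w_mult \<tau>) (w_mult \<theta> \<sigma>)"
    by (rule lin_cong)
      (use keys_w_mult[OF assms(2,3)] assms(1) in \<open>simp add: w_mult_eq W_def add.assoc\<close>)
  finally show ?thesis .
qed

lemma empty_Pi_std: "{} \<in> Pi_std"
  by (auto simp: Pi_std_def partition_on_def intro!: exI[of _ 0])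

lemma ground_size_empty [simp]: "ground_size {} = 0"
  by (simp add: ground_size_def)

text \<open>With an empty factor only one subset occurs in the sum, and the other factor is shifted
  onto its own ground set.\<close>

lemma w_mult_unit:
  assumes "\<pi> \<in> Pi_std"
  shows "w_mult {} \<pi> = Poly_Mapping.single \<pi> 1" "w_mult \<pi> {} = Poly_Mapping.single \<pi> 1"
proof -
  have "subsets_of_card {1..ground_size \<pi>} 0 = {{}}"
    by (auto dest: finite_subset)
  then show "w_mult {} \<pi> = Poly_Mapping.single \<pi> 1"
    using shift_Pi_std[OF assms] by (simp add: w_mult_eq[OF empty_Pi_std assms])
  have "subsets_of_card {1..ground_size \<pi>} (ground_size \<pi>) = {{1..ground_size \<pi>}}"
    using card_subset_eq[of "{1..ground_size \<pi>}"] by auto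
  then show "w_mult \<pi> {} = Poly_Mapping.single \<pi> 1"
    using shift_Pi_std[OF assms] by (simp add: w_mult_eq[OF assms empty_Pi_std])
qed

lemma NCSym_dual_eq: "NCSym_dual = based_algebra Pi_std {} w_mult"
  by (simp add: NCSym_dual_def w_mult_def[abs_def])

lemma assoc_algebra_NCSym_dual: "assoc_algebra Q_field NCSym_dual"
  unfolding NCSym_dual_eq
  by (rule assoc_algebra_based_algebra)
    (auto simp: empty_Pi_std w_mult_unit w_mult_assoc dest: keys_w_mult)

section \<open>Shuffle-compatible statistics\<close>

lemma std_Pi_std:
  assumes "\<pi> \<in> Psi"
  shows "std \<pi> \<in> Pi_std" "ground_size (std \<pi>) = ground_size \<pi>"
  using assms partition_on_shift[of \<pi> "{1..ground_size \<pi>}"] Union_shift[of \<pi> "{1..ground_size \<pi>}"]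
  by (auto simp: Pi_std_def std_def Psi_def ground_size_def simp del: Union_iff)

text \<open>Standardization is idempotent, so \<open>\<pi>\<close> and \<open>std \<pi>\<close> have
  the same standardization.\<close>

lemma st_std:
  assumes "shuffle_compatible st" "\<pi> \<in> Psi"
  shows "st (std \<pi>) = st \<pi>"
proof -
  have "std (std \<pi>) = std \<pi>"
    using std_shift[of \<pi> "{1..ground_size \<pi>}", folded std_def] assms by simp
  then show ?thesis
    using assms std_Pi_std Pi_std_imp_Psi unfolding shuffle_compatible_def by blast
qed

lemma st_translate:
  assumes "shuffle_compatible st" "\<theta> \<in> Psi"
  shows "st (translate n \<theta>) = st \<theta>"
  using assms translate_Psi std_translate unfolding shuffle_compatible_def by blast

text \<open>A shifted arc-shuffle is the arc-shuffle with a translated second factor. Translation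
  makes the factors disjoint and changes neither size nor value of \<open>st\<close>.\<close>

lemma shuffle_compatible_imp_weakly:
  assumes st: "shuffle_compatible st"
  shows "weakly_shuffle_compatible st"
  unfolding weakly_shuffle_compatible_def ASh_shifted_def
proof (intro ballI impI)
  fix \<tau> \<theta> \<tau>' \<theta>'
  assume P: "\<tau> \<in> Pi_std" "\<theta> \<in> Pi_std" "\<tau>' \<in> Pi_std" "\<theta>' \<in> Pi_std"
    and eq: "st \<tau> = st \<tau>'" "st \<theta> = st \<theta>'" "ground_size \<tau> = ground_size \<tau>'" "ground_size \<theta> = ground_size \<theta>'"
  let ?\<theta> = "translate (ground_size \<tau>) \<theta>" and ?\<theta>' = "translate (ground_size \<tau>') \<theta>'"
  have "?\<theta> \<in> Psi" "?\<theta>' \<in> Psi" "st ?\<theta> = st ?\<theta>'" "ground_size ?\<theta> = ground_size ?\<theta>'"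
    using P eq st by (simp_all add: translate_Psi Pi_std_imp_Psi st_translate ground_size_translate)
  then show "image_mset st (ASh \<tau> ?\<theta>) = image_mset st (ASh \<tau>' ?\<theta>')"
    using st P eq translate_disjoint Pi_std_imp_Psi unfolding shuffle_compatible_def by blast
qed

section \<open>Standard representatives and the maps between the three algebras\<close>

text \<open>The class of \<open>\<pi>\<close> is also the class of \<open>std \<pi>\<close>. This
  gives surjectivity at the level of bases.\<close>

lemma st_class_image_Pi_std:
  assumes "shuffle_compatible st"
  shows "st_class Psi st ` Pi_std = st_classes Psi st"
proof -
  have "st_class Psi st \<pi> \<in> st_class Psi st ` Pi_std" if "\<pi> \<in> Psi" for \<pi>
    by (rule image_eqI[of _ _ "std \<pi>"])
      (use that assms in \<open>auto simp: st_class_def st_std std_Pi_std\<close>)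
  then show ?thesis by (auto simp: st_classes_def Pi_std_imp_Psi)
qed

text \<open>The translate of \<open>\<theta>\<close> represents the same class and is disjoint from
  \<open>\<tau>\<close>, so the product of classes can be computed from the shifted
  arc-shuffle.\<close>

lemma Psi_mult_st_class:
  assumes "shuffle_compatible st" "\<tau> \<in> Pi_std" "\<theta> \<in> Pi_std"
  shows "Psi_mult st (st_class Psi st \<tau>) (st_class Psi st \<theta>) = push (st_class Psi st) (w_mult \<tau> \<theta>)"
proof -
  let ?\<theta> = "translate (ground_size \<tau>) \<theta>"
  have "st_class Psi st \<theta> = st_class Psi st ?\<theta>"
    using assms by (simp add: st_class_def st_translate Pi_std_imp_Psi ground_size_translate)
  then show ?thesis
    using Psi_mult_class[OF assms(1) Pi_std_imp_Psi[OF assms(2)] translate_Psi[OF Pi_std_imp_Psi[OF assms(3)]]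
      translate_disjoint[OF assms(2,3)]]
    by (simp add: w_mult_def push_formal_sum ASh_shifted_def)
qed

text \<open>\<open>ring_hom\<close> speaks only of the operations, so it is available before
  \<open>A_Psi st\<close> is known to be a ring; the axioms then follow by surjectivity.\<close>

lemma NCSym_dual_hom:
  assumes "shuffle_compatible st"
  shows "push (st_class Psi st) \<in> ring_hom NCSym_dual (A_Psi st)"
    "push (st_class Psi st) ` carrier NCSym_dual = carrier (A_Psi st)"
  unfolding NCSym_dual_eq A_Psi_def based_algebra_simps
  using st_class_image_Pi_std[OF assms] Psi_mult_st_class[OF assms]
  by (auto intro!: push_ring_hom simp: push_image)

lemma assoc_algebra_A_Psi:
  assumes "shuffle_compatible st"
  shows "assoc_algebra Q_field (A_Psi st)"
  by (rule assoc_algebra_hom_image[OF assoc_algebra_NCSym_dual NCSym_dual_hom[OF assms]])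
    (simp_all add: NCSym_dual_eq A_Psi_def based_algebra_simps lin_scale)

text \<open>Intersection with \<open>Pi_std\<close> thus compares the two kinds of classes without a
  choice of representatives.\<close>

lemma st_class_Int_Pi_std: "st_class Psi st \<pi> \<inter> Pi_std = st_class Pi_std st \<pi>"
  using Pi_std_imp_Psi by (auto simp: st_class_def)

lemma A_Psi_iso_A_Pi:
  assumes "shuffle_compatible st"
  shows "push (\<lambda>C. C \<inter> Pi_std) \<in> algebra_iso Q_field (A_Psi st) (A_Pi st)"
proof -
  let ?f = "\<lambda>C. C \<inter> Pi_std"
  have classes: "st_classes Psi st = st_class Psi st ` Pi_std"
    by (rule st_class_image_Pi_std[OF assms, symmetric])
  have image: "?f ` st_classes Psi st = st_classes Pi_std st"
    unfolding classes by (simp add: image_image st_class_Int_Pi_std st_classes_def)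
  have "inj_on ?f (st_classes Psi st)"
    unfolding classes
  proof (rule inj_onI, clarify)
    fix \<tau> \<theta>
    assume "\<tau> \<in> Pi_std" "\<theta> \<in> Pi_std" and eq: "st_class Psi st \<tau> \<inter> Pi_std = st_class Psi st \<theta> \<inter> Pi_std"
    \<comment> \<open>The standard partition \<open>\<tau>\<close> lies in the first intersection,
      hence in the second.\<close>
    then have "\<tau> \<in> st_class Pi_std st \<theta>"
      unfolding st_class_Int_Pi_std by (auto simp: st_class_def)
    then show "st_class Psi st \<tau> = st_class Psi st \<theta>" by (auto simp: st_class_def)
  qed
  then have bij: "bij_betw (push ?f) (carrier (A_Psi st)) (carrier (A_Pi st))"
    unfolding A_Psi_def A_Pi_def based_algebra_simps bij_betw_def
    by (simp add: push_inj push_image image)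
  have mult: "Pi_mult st (?f C) (?f D) = push ?f (Psi_mult st C D)"
    if CD: "C \<in> st_classes Psi st" "D \<in> st_classes Psi st" for C D
  proof -
    obtain \<tau> \<theta> where \<tau>\<theta>: "\<tau> \<in> Pi_std" "\<theta> \<in> Pi_std" "C = st_class Psi st \<tau>" "D = st_class Psi st \<theta>"
      using CD unfolding classes by blast
    \<comment> \<open>For standard representatives both products are images of the same element
      \<open>w_mult \<tau> \<theta>\<close>.\<close>
    then have "Pi_mult st (?f C) (?f D) = push (st_class Pi_std st) (w_mult \<tau> \<theta>)"
      by (simp add: st_class_Int_Pi_std Pi_mult_class shuffle_compatible_imp_weakly[OF assms]
          w_mult_def push_formal_sum)
    also have "\<dots> = push ?f (Psi_mult st C D)"
      using \<tau>\<theta> by (simp add: Psi_mult_st_class[OF assms] lin_lin st_class_Int_Pi_std)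
    finally show ?thesis .
  qed
  have "push ?f \<in> ring_hom (A_Psi st) (A_Pi st)"
    unfolding A_Psi_def A_Pi_def
    by (rule push_ring_hom) (use image mult in \<open>auto simp: st_class_Int_Pi_std\<close>)
  then show ?thesis
    using bij
    by (simp add: algebra_iso_def ring_iso_def A_Psi_def A_Pi_def based_algebra_simps lin_scale)
qed

theorem proposition5p15:
  fixes st :: "setpart \<Rightarrow> 'b"
  assumes "shuffle_compatible st"
  shows "weakly_shuffle_compatible st \<and>
    algebra_isomorphic Q_field (A_Psi st) (A_Pi st) \<and>
    (\<exists>I. ideal I NCSym_dual \<and>
       algebra_isomorphic Q_field (A_Psi st) (quot_algebra NCSym_dual I))"
proof (intro conjI)
  show "weakly_shuffle_compatible st"
    by (rule shuffle_compatible_imp_weakly[OF assms])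
  have iso: "push (\<lambda>C. C \<inter> Pi_std) \<in> algebra_iso Q_field (A_Psi st) (A_Pi st)"
    by (rule A_Psi_iso_A_Pi[OF assms])
  then have "push (\<lambda>C. C \<inter> Pi_std) \<in> ring_hom (A_Psi st) (A_Pi st)"
    "push (\<lambda>C. C \<inter> Pi_std) ` carrier (A_Psi st) = carrier (A_Pi st)"
    by (auto simp only: algebra_iso_def ring_iso_def bij_betw_def)
  \<comment> \<open>The isomorphism is in particular a surjective homomorphism, so it carries the
    axioms of \<open>A_Psi st\<close> over to \<open>A_Pi st\<close>.\<close>
  then have "assoc_algebra Q_field (A_Pi st)"
    by (rule assoc_algebra_hom_image[OF assoc_algebra_A_Psi[OF assms]])
      (simp_all add: A_Psi_def A_Pi_def based_algebra_simps lin_scale)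
  with iso show "algebra_isomorphic Q_field (A_Psi st) (A_Pi st)"
    using assoc_algebra_A_Psi[OF assms] by (auto simp: algebra_isomorphic_def)
  show "\<exists>I. ideal I NCSym_dual \<and>
      algebra_isomorphic Q_field (A_Psi st) (quot_algebra NCSym_dual I)"
    by (rule first_isomorphism[OF assoc_algebra_NCSym_dual NCSym_dual_hom[OF assms]])
      (simp_all add: NCSym_dual_eq A_Psi_def based_algebra_simps lin_scale)
qed

end
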